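(* Let $m \geq 4$ be an integer and let $G$ and $G'$ be $m$-edge-coloured graphs. Then $G$ and $G'$ are $A_m$-switch equivalent if and only if $\mathit{underlying}(G) \cong \mathit{underlying}(G')$.
   Context: Graphs are finite, undirected and simple (no loops, no multiple edges). An $m$-edge-coloured graph is a pair $G=(H,\Sigma)$ where $H$ is a graph and $\Sigma: E(H)\to\{1,\dots,m\}$ is any function; $\Sigma(e)$ is the colour of $e$. We write $\mathit{underlying}(G)=H$ and $\Sigma(G)=\Sigma$. An isomorphism of $m$-edge-coloured graphs is an isomorphism of the underlying graphs that preserves edge colours. $S_m$ is the symmetric group on $\{1,\dots,m\}$ and $A_m$ is the alternating group, viewed as a subgroup of $S_m$. Let $\Gamma$ be a subgroup of $S_m$. For a vertex $x$ of $G$ and $\pi\in\Gamma$, switching at $x$ with respect to $\pi$ transforms $G$ into the $m$-edge-coloured graph $G^{(x,\pi)}$ with the same underlying graph, in which each edge $xy$ incident with $x$ has colour $\pi(\Sigma(G)(xy))$ and all other edges keep their colours. A $\Gamma$-switching sequence is a finite sequence $\mathcal{S}=(x_1,\pi_1),\dots,(x_t,\pi_t)$ of elements of $V(G)\times\Gamma$, and $G^{\mathcal{S}}$ is the result of performing these switches successively in order. $G$ and $G'$ are $\Gamma$-switch equivalent if there is a $\Gamma$-switching sequence $\mathcal{S}$ with $G^{\mathcal{S}}\cong G'$ (isomorphism of $m$-edge-coloured graphs). *)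

theory Defs
  imports "HOL-Algebra.Sym_Groups"
begin

record 'a ugraph =
  verts :: "'a set"
  edges :: "'a set set"

definition simple_graph :: "'a ugraph \<Rightarrow> bool" where
  "simple_graph H \<longleftrightarrow>
     finite (verts H) \<and> (\<forall>e\<in>edges H. e \<subseteq> verts H \<and> card e = 2)"

definition graph_isomorphism :: "('a \<Rightarrow> 'b) \<Rightarrow> 'a ugraph \<Rightarrow> 'b ugraph \<Rightarrow> bool" where
  "graph_isomorphism f H H' \<longleftrightarrow>
     bij_betw f (verts H) (verts H') \<and>
     (\<forall>u\<in>verts H. \<forall>v\<in>verts H. {u, v} \<in> edges H \<longleftrightarrow> {f u, f v} \<in> edges H')"

definition graph_isomorphic :: "'a ugraph \<Rightarrow> 'b ugraph \<Rightarrow> bool" where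
  "graph_isomorphic H H' \<longleftrightarrow> (\<exists>f. graph_isomorphism f H H')"

text \<open>Only the values of \<open>colour\<close> on edges are meaningful; no notion below depends on the others.\<close>

record 'a coloured_graph =
  underlying :: "'a ugraph"
  colour :: "'a set \<Rightarrow> nat"

definition edge_coloured_graph :: "nat \<Rightarrow> 'a coloured_graph \<Rightarrow> bool" where
  "edge_coloured_graph m G \<longleftrightarrow>
     simple_graph (underlying G) \<and> colour G \<in> edges (underlying G) \<rightarrow> {1..m}"

definition coloured_isomorphism ::
    "('a \<Rightarrow> 'b) \<Rightarrow> 'a coloured_graph \<Rightarrow> 'b coloured_graph \<Rightarrow> bool" where
  "coloured_isomorphism f G G' \<longleftrightarrow>
     graph_isomorphism f (underlying G) (underlying G') \<and>
     (\<forall>e\<in>edges (underlying G). colour G' (f ` e) = colour G e)"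

definition coloured_isomorphic :: "'a coloured_graph \<Rightarrow> 'b coloured_graph \<Rightarrow> bool" where
  "coloured_isomorphic G G' \<longleftrightarrow> (\<exists>f. coloured_isomorphism f G G')"

definition switch :: "'a \<Rightarrow> (nat \<Rightarrow> nat) \<Rightarrow> 'a coloured_graph \<Rightarrow> 'a coloured_graph" where
  "switch x \<pi> G = G\<lparr>colour :=
     (\<lambda>e. if e \<in> edges (underlying G) \<and> x \<in> e then \<pi> (colour G e) else colour G e)\<rparr>"

definition switch_seq ::
    "('a \<times> (nat \<Rightarrow> nat)) list \<Rightarrow> 'a coloured_graph \<Rightarrow> 'a coloured_graph" where
  "switch_seq S G = fold (\<lambda>(x, \<pi>). switch x \<pi>) S G"

text \<open>\<open>\<Gamma>\<close> is the carrier of a subgroup of \<^term>\<open>sym_group m\<close>, whose elements are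
  permutations of \<^term>\<open>{1..m}\<close> extended by the identity to all natural numbers.\<close>

definition switch_equivalent ::
    "(nat \<Rightarrow> nat) set \<Rightarrow> 'a coloured_graph \<Rightarrow> 'b coloured_graph \<Rightarrow> bool" where
  "switch_equivalent \<Gamma> G G' \<longleftrightarrow>
     (\<exists>S. set S \<subseteq> verts (underlying G) \<times> \<Gamma> \<and> coloured_isomorphic (switch_seq S G) G')"

lemma subgroup_alt_group: "subgroup (carrier (alt_group m)) (sym_group m)"
  by (rule alt_group_is_subgroup)

lemma edge_coloured_graph_switch:
  assumes "edge_coloured_graph m G" "\<pi> \<in> carrier (sym_group m)"
  shows "edge_coloured_graph m (switch x \<pi> G)"
proof -
  have "\<pi> c \<in> {1..m}" if "c \<in> {1..m}" for c
    using assms(2) that permutes_in_image[of \<pi> "{1..m}" c] by (simp add: sym_group_def)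
  then show ?thesis
    using assms(1) by (auto simp: edge_coloured_graph_def switch_def Pi_iff)
qed

end

theory Submission
  imports Defs
begin

text \<open>
  Switching never touches the underlying graph, so only the converse has content: all colourings of
  a graph can be turned into one another. The idea is to recolour a single edge \<open>uv\<close> without
  disturbing any other. Switch at \<open>u\<close>, at \<open>v\<close>, and then undo both switches in the same order: an
  edge that meets only one of \<open>u\<close> and \<open>v\<close> sees a permutation followed by its inverse, while \<open>uv\<close>
  itself sees the commutator of the two permutations (\<open>switch_seq_commutator\<close>). The commutator acts
  nontrivially because even permutations of at least four points need not commute: two \<open>3\<close>-cycles
  that overlap suitably have a commutator that moves one prescribed colour to another
  (\<open>recolour_edge\<close>). As the edge set is finite, the edges can be recoloured one after the other to
  match the colouring pulled back along a given isomorphism of the underlying graphs.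
\<close>

lemma underlying_switch_seq [simp]: "underlying (switch_seq S G) = underlying G"
  by (induction S arbitrary: G) (auto simp: switch_seq_def switch_def)

lemma switch_seq_append: "switch_seq (S @ T) G = switch_seq T (switch_seq S G)"
  by (simp add: switch_seq_def)

lemma simple_graph_finite_edges:
  assumes "simple_graph H"
  shows "finite (edges H)"
proof (rule finite_subset)
  show "edges H \<subseteq> Pow (verts H)" "finite (Pow (verts H))"
    using assms by (auto simp: simple_graph_def)
qed

lemma simple_graph_edgeE:
  assumes "simple_graph H" "e \<in> edges H"
  obtains u v where "e = {u, v}" "u \<noteq> v" "u \<in> verts H" "v \<in> verts H"
  using assms by (auto simp: simple_graph_def card_2_iff)

text \<open>
  The edges at \<open>u\<close> other than \<open>uv\<close> see only \<open>p\<close> and then \<open>p'\<close>, those at \<open>v\<close> only \<open>q\<close> and then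
  \<open>q'\<close>; both pairs cancel. Only \<open>uv\<close> feels all four switches, and no other edge contains both ends
  because the graph is simple.
\<close>

lemma switch_seq_commutator:
  assumes "simple_graph (underlying G)" and uv: "{u, v} \<in> edges (underlying G)" "u \<noteq> v"
    and inv: "\<And>c. p' (p c) = c" "\<And>c. q' (q c) = c"
  shows "switch_seq [(u, p), (v, q), (u, p'), (v, q')] G =
         G\<lparr>colour := (colour G)({u, v} := q' (p' (q (p (colour G {u, v})))))\<rparr>"
proof -
  let ?S = "[(u, p), (v, q), (u, p'), (v, q')]"
  let ?C = "(colour G)({u, v} := q' (p' (q (p (colour G {u, v})))))"
  have "colour (switch_seq ?S G) e = ?C e" for e
  proof (cases "e \<in> edges (underlying G) \<and> u \<in> e \<and> v \<in> e")
    case True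
    then have "card e = 2" "{u, v} \<subseteq> e"
      using assms(1) by (auto simp: simple_graph_def)
    then have "e = {u, v}"
      using \<open>u \<noteq> v\<close> card_subset_eq[of e "{u, v}"] card_ge_0_finite[of e] by simp
    then show ?thesis
      using uv(1) by (simp add: switch_seq_def switch_def)
  next
    case False
    then have "e \<noteq> {u, v}"
      using uv(1) by auto
    then show ?thesis
      using False by (simp add: switch_seq_def switch_def inv)
  qed
  then have "colour (switch_seq ?S G) = ?C"
    by (rule ext)
  then show ?thesis
    by (simp add: switch_seq_def switch_def)
qed

definition three_cycle :: "'a \<Rightarrow> 'a \<Rightarrow> 'a \<Rightarrow> 'a \<Rightarrow> 'a" where
  "three_cycle a b c = transpose a b \<circ> transpose b c"

lemma three_cycle_apply:
  assumes "distinct [a, b, c]"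
  shows "three_cycle a b c a = b" "three_cycle a b c b = c"
    "x \<notin> {a, b, c} \<Longrightarrow> three_cycle a b c x = x"
  using assms by (auto simp: three_cycle_def transpose_def)

lemma three_cycle_reverse: "three_cycle c b a (three_cycle a b c x) = x"
  by (simp add: three_cycle_def transpose_commute)

lemma three_cycle_in_alt_group:
  assumes "{a, b, c} \<subseteq> {1..m}" "distinct [a, b, c]"
  shows "three_cycle a b c \<in> carrier (alt_group m)"
  using assms unfolding alt_group_carrier sym_group_def three_cycle_def
  by (auto simp: evenperm_comp permutation_swap_id evenperm_swap
      intro!: permutes_compose permutes_swap_id)

text \<open>
  Four colours are exactly what is needed to move colour \<open>c\<close> to colour \<open>d\<close>: with two auxiliary
  colours \<open>a\<close> and \<open>b\<close>, the commutator of the cycles \<open>(c d a)\<close> and \<open>(d b a)\<close> sends \<open>c\<close> first to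
  \<open>d\<close>, then to \<open>b\<close>, which the inverse of the first cycle fixes, and finally back to \<open>d\<close>.
\<close>

lemma recolour_edge:
  assumes "m \<ge> 4" and G: "edge_coloured_graph m G"
    and e: "e \<in> edges (underlying G)" and d: "d \<in> {1..m}"
  shows "\<exists>S. set S \<subseteq> verts (underlying G) \<times> carrier (alt_group m) \<and>
             switch_seq S G = G\<lparr>colour := (colour G)(e := d)\<rparr>"
proof (cases "colour G e = d")
  case True
  then show ?thesis
    by (intro exI[of _ "[]"]) (auto simp: switch_seq_def)
next
  case False
  define c where "c = colour G e"
  have simple: "simple_graph (underlying G)" and c: "c \<in> {1..m}"
    using G e by (auto simp: edge_coloured_graph_def c_def)
  obtain u v where uv: "e = {u, v}" "u \<noteq> v" "u \<in> verts (underlying G)" "v \<in> verts (underlying G)"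
    using simple_graph_edgeE[OF simple e] .
  have "card {c, d} = 2"
    using False by (simp add: c_def)
  then have "card ({1..m} - {c, d}) \<ge> 2"
    using c d \<open>m \<ge> 4\<close> by (subst card_Diff_subset) auto
  then obtain T where "T \<subseteq> {1..m} - {c, d}" "card T = 2"
    using obtain_subset_with_card_n by metis
  then obtain a b where ab: "a \<noteq> b" "{a, b} \<subseteq> {1..m} - {c, d}"
    by (auto simp: card_2_iff)
  have dist: "distinct [c, d, a]" "distinct [d, b, a]" "distinct [a, d, c]" "distinct [a, b, d]"
    using ab False by (auto simp: c_def)
  let ?S = "[(u, three_cycle c d a), (v, three_cycle d b a),
             (u, three_cycle a d c), (v, three_cycle a b d)]"
  have "b \<notin> {a, d, c}"
    using ab by auto
  moreover have "three_cycle a b d b = d"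
    using dist by (simp add: three_cycle_apply)
  ultimately have "three_cycle a b d (three_cycle a d c (three_cycle d b a (three_cycle c d a c))) = d"
    by (simp add: three_cycle_apply(1)[OF dist(1)] three_cycle_apply(1)[OF dist(2)]
        three_cycle_apply(3)[OF dist(3)])
  then have "switch_seq ?S G = G\<lparr>colour := (colour G)(e := d)\<rparr>"
    using simple e uv(2) unfolding c_def uv(1)
    by (subst switch_seq_commutator) (simp_all add: three_cycle_reverse)
  moreover have "set ?S \<subseteq> verts (underlying G) \<times> carrier (alt_group m)"
    using uv ab c d dist by (auto intro!: three_cycle_in_alt_group)
  ultimately show ?thesis
    by blast
qed

lemma recolour_edges:
  assumes "m \<ge> 4" and G: "edge_coloured_graph m G"
    and k: "k \<in> edges (underlying G) \<rightarrow> {1..m}"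
    and "finite F" "F \<subseteq> edges (underlying G)"
  shows "\<exists>S. set S \<subseteq> verts (underlying G) \<times> carrier (alt_group m) \<and>
             switch_seq S G = G\<lparr>colour := \<lambda>e. if e \<in> F then k e else colour G e\<rparr>"
  using assms(4,5)
proof (induction F)
  case empty
  show ?case
    by (intro exI[of _ "[]"]) (auto simp: switch_seq_def)
next
  case (insert e F)
  let ?H = "G\<lparr>colour := \<lambda>e. if e \<in> F then k e else colour G e\<rparr>"
  obtain S where S: "set S \<subseteq> verts (underlying G) \<times> carrier (alt_group m)" "switch_seq S G = ?H"
    using insert by auto
  have "edge_coloured_graph m ?H" "e \<in> edges (underlying ?H)" "k e \<in> {1..m}"
    using G k insert.prems by (auto simp: edge_coloured_graph_def Pi_iff simp del: atLeastAtMost_iff)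
  then obtain T where T: "set T \<subseteq> verts (underlying G) \<times> carrier (alt_group m)"
      "switch_seq T ?H = ?H\<lparr>colour := (colour ?H)(e := k e)\<rparr>"
    using recolour_edge[OF \<open>m \<ge> 4\<close>, of ?H e "k e"] by auto
  have "switch_seq (S @ T) G = G\<lparr>colour := \<lambda>e'. if e' \<in> insert e F then k e' else colour G e'\<rparr>"
    unfolding switch_seq_append S(2) T(2) by (auto simp: fun_eq_iff)
  then show ?case
    using S(1) T(1) by (intro exI[of _ "S @ T"]) auto
qed

lemma graph_isomorphism_image_edge:
  assumes "graph_isomorphism f H H'" "simple_graph H" "e \<in> edges H"
  shows "f ` e \<in> edges H'"
proof -
  obtain u v where uv: "e = {u, v}" "u \<in> verts H" "v \<in> verts H"
    using simple_graph_edgeE[OF assms(2,3)] by metis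
  have "{f u, f v} \<in> edges H'"
    using assms(1,3) uv unfolding graph_isomorphism_def by blast
  then show ?thesis
    by (simp add: uv(1))
qed

theorem corollary2p6:
  fixes m :: nat
    and G :: "'a coloured_graph"
    and G' :: "'b coloured_graph"
  assumes "m \<ge> 4"
    and "edge_coloured_graph m G"
    and "edge_coloured_graph m G'"
  shows "switch_equivalent (carrier (alt_group m)) G G' \<longleftrightarrow>
         graph_isomorphic (underlying G) (underlying G')"
proof
  assume "switch_equivalent (carrier (alt_group m)) G G'"
  then show "graph_isomorphic (underlying G) (underlying G')"
    by (auto simp: switch_equivalent_def coloured_isomorphic_def coloured_isomorphism_def
        graph_isomorphic_def)
next
  assume "graph_isomorphic (underlying G) (underlying G')"
  then obtain f where f: "graph_isomorphism f (underlying G) (underlying G')"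
    by (auto simp: graph_isomorphic_def)
  have simple: "simple_graph (underlying G)"
    using assms(2) by (simp add: edge_coloured_graph_def)
  let ?k = "\<lambda>e. colour G' (f ` e)"
  have "?k \<in> edges (underlying G) \<rightarrow> {1..m}"
    using graph_isomorphism_image_edge[OF f simple] assms(3)
    by (auto simp: edge_coloured_graph_def Pi_iff)
  then obtain S where S: "set S \<subseteq> verts (underlying G) \<times> carrier (alt_group m)"
      "switch_seq S G =
         G\<lparr>colour := \<lambda>e. if e \<in> edges (underlying G) then ?k e else colour G e\<rparr>"
    using recolour_edges[OF assms(1,2) _ simple_graph_finite_edges[OF simple] order_refl]
    by blast
  have "coloured_isomorphism f (switch_seq S G) G'"
    using f by (simp add: S(2) coloured_isomorphism_def)
  then show "switch_equivalent (carrier (alt_group m)) G G'"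
    using S(1) by (auto simp: switch_equivalent_def coloured_isomorphic_def)
qed

end
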